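(* Let $H$ be a Hilbert space and let $A$ be an unbounded self-adjoint operator in $H$ with partition of unity $E_t$, $t\in\mathbb{R}$. Let $\varphi,\psi:\mathbb{R}\to\mathbb{C}$ be continuous functions such that $|\varphi|$ and $|\psi|$ are even and strictly increasing on $(0,\infty)$, and suppose that $|\varphi(t)|^2=F(|\psi(t)|^2)$ for all $t\in\mathbb{R}$, where $F:[0,\infty)\to[0,\infty)$ is strictly increasing and concave with $F(0)=0$. Then for every $x\in D(\psi(A))$, $x\neq\theta$, $$\|\varphi(A)x\|^2\le \|x\|^2\,F\left(\frac{\|\psi(A)x\|^2}{\|x\|^2}\right).$$ If, in addition, $(E_t-E_s)D(\psi(A))\neq\{\theta\}$ for all $0\le s<t\le\infty$, then this inequality is exact, i.e. for every $c<1$ there is $x\in D(\psi(A))$, $x\ne\theta$, with $$\|\varphi(A)x\|^2> c\,\|x\|^2\,F\left(\frac{\|\psi(A)x\|^2}{\|x\|^2}\right).$$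
   Context: $\theta$ denotes the zero element of $H$. The partition of unity (spectral family) $E_t$ of $A$ is the family of projections with $E_uE_v=E_{\min\{u,v\}}$, strongly left-continuous ($E_{t-0}=E_t$), $E_{-\infty}=0$, $E_{\infty}=I$ (strong limits), and $A=\int_{-\infty}^{+\infty}t\,dE_t$. For a function $f$ on $\mathbb{R}$ (measurable and finite almost everywhere with respect to $E_t$), $D(f(A))=\{x\in H:\int_{-\infty}^{+\infty}|f(t)|^2\,d(E_tx,x)<\infty\}$ and $f(A)x=\int_{-\infty}^{+\infty}f(t)\,dE_tx$ for $x\in D(f(A))$. *)

theory Defs
  imports "HOL-Analysis.Analysis"
begin

section \<open>Complex Hilbert spaces\<close>

text \<open>
  The norm and the metric are those of the underlying real inner product space; by
  \<open>Re_cinner\<close> and \<open>cinner_commute\<close> the norm is the one induced by the complex inner product.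
  The inner product is linear in its first argument.
\<close>

class complex_inner_space = real_inner +
  fixes scaleC :: "complex \<Rightarrow> 'a \<Rightarrow> 'a" (infixr \<open>*\<^sub>C\<close> 75)
    and cinner :: "'a \<Rightarrow> 'a \<Rightarrow> complex"
  assumes scaleC_add_right: "c *\<^sub>C (x + y) = c *\<^sub>C x + c *\<^sub>C y"
    and scaleC_add_left: "(c + d) *\<^sub>C x = c *\<^sub>C x + d *\<^sub>C x"
    and scaleC_scaleC: "c *\<^sub>C (d *\<^sub>C x) = (c * d) *\<^sub>C x"
    and scaleC_of_real: "complex_of_real r *\<^sub>C x = r *\<^sub>R x"
    and cinner_commute: "cinner x y = cnj (cinner y x)"
    and cinner_add_left: "cinner (x + y) z = cinner x z + cinner y z"
    and cinner_scaleC_left: "cinner (c *\<^sub>C x) y = c * cinner x y"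
    and Re_cinner: "Re (cinner x y) = inner x y"

class complex_hilbert_space = complex_inner_space + complete_space

section \<open>Operators\<close>

text \<open>
  A partially defined operator is given by its domain \<open>D\<close> and a total function \<open>A\<close> whose values
  outside \<open>D\<close> are irrelevant.
\<close>

definition linear_operator_on ::
    "'h::complex_inner_space set \<Rightarrow> ('h \<Rightarrow> 'h) \<Rightarrow> bool" where
  "linear_operator_on D A \<longleftrightarrow>
     0 \<in> D \<and> (\<forall>x\<in>D. \<forall>y\<in>D. x + y \<in> D \<and> A (x + y) = A x + A y) \<and>
     (\<forall>c. \<forall>x\<in>D. c *\<^sub>C x \<in> D \<and> A (c *\<^sub>C x) = c *\<^sub>C A x)"

text \<open>The last conjunct says that the graph of the adjoint is the graph of the operator itself.\<close>

definition self_adjoint_operator ::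
    "'h::complex_inner_space set \<Rightarrow> ('h \<Rightarrow> 'h) \<Rightarrow> bool" where
  "self_adjoint_operator D A \<longleftrightarrow>
     linear_operator_on D A \<and> closure D = UNIV \<and>
     (\<forall>y z. (\<forall>x\<in>D. cinner (A x) y = cinner x z) \<longleftrightarrow> y \<in> D \<and> A y = z)"

definition bounded_operator_on ::
    "'h::complex_inner_space set \<Rightarrow> ('h \<Rightarrow> 'h) \<Rightarrow> bool" where
  "bounded_operator_on D A \<longleftrightarrow> (\<exists>K. \<forall>x\<in>D. norm (A x) \<le> K * norm x)"

definition orthogonal_projection :: "('h::complex_inner_space \<Rightarrow> 'h) \<Rightarrow> bool" where
  "orthogonal_projection P \<longleftrightarrow>
     linear_operator_on UNIV P \<and> (\<forall>x. P (P x) = P x) \<and>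
     (\<forall>x y. cinner (P x) y = cinner x (P y))"

section \<open>Partitions of unity and the functional calculus\<close>

definition partition_of_unity :: "(real \<Rightarrow> 'h::complex_inner_space \<Rightarrow> 'h) \<Rightarrow> bool" where
  "partition_of_unity E \<longleftrightarrow>
     (\<forall>t. orthogonal_projection (E t)) \<and>
     (\<forall>u v x. E u (E v x) = E (min u v) x) \<and>
     (\<forall>t x. ((\<lambda>s. E s x) \<longlongrightarrow> E t x) (at_left t)) \<and>
     (\<forall>x. ((\<lambda>t. E t x) \<longlongrightarrow> 0) at_bot) \<and>
     (\<forall>x. ((\<lambda>t. E t x) \<longlongrightarrow> x) at_top)"

definition extended_family ::
    "(real \<Rightarrow> 'h::complex_inner_space \<Rightarrow> 'h) \<Rightarrow> ereal \<Rightarrow> 'h \<Rightarrow> 'h" where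
  "extended_family E t x =
     (case t of ereal r \<Rightarrow> E r x | PInfty \<Rightarrow> x | MInfty \<Rightarrow> 0)"

text \<open>
  The Stieltjes measure of the nondecreasing left-continuous function
  \<open>t \<mapsto> (E t x, x)\<close>.  Since \<open>interval_measure\<close> expects right-continuous functions, the line is
  reflected before and after; see \<open>emeasure_spectral_measure\<close> below for the resulting value
  on \<open>{a..<b}\<close>.
\<close>

definition spectral_measure ::
    "(real \<Rightarrow> 'h::complex_inner_space \<Rightarrow> 'h) \<Rightarrow> 'h \<Rightarrow> real measure" where
  "spectral_measure E x =
     distr (interval_measure (\<lambda>t. - Re (cinner (E (- t) x) x))) borel uminus"

text \<open>
  A list of triples \<open>(c, a, b)\<close> encodes the step function that is the sum of the functions
  \<open>c\<close> times the indicator of \<open>{a..<b}\<close>.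
\<close>

definition step_function :: "(complex \<times> real \<times> real) list \<Rightarrow> real \<Rightarrow> complex" where
  "step_function ps t = (\<Sum>(c, a, b)\<leftarrow>ps. c * indicator {a..<b} t)"

definition step_integral ::
    "(real \<Rightarrow> 'h::complex_inner_space \<Rightarrow> 'h) \<Rightarrow> 'h \<Rightarrow> (complex \<times> real \<times> real) list \<Rightarrow> 'h" where
  "step_integral E x ps = (\<Sum>(c, a, b)\<leftarrow>ps. c *\<^sub>C (E b x - E a x))"

text \<open>
  The vector integral of \<open>f\<close> against \<open>dE\<^sub>t x\<close>: the limit of the integrals of step functions
  that converge to \<open>f\<close> in the \<open>L\<^sup>2\<close> space of the spectral measure of \<open>x\<close>.
  The elementary integral is isometric, so the limit does not depend on the sequence.
\<close>

definition has_spectral_integral ::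
    "(real \<Rightarrow> 'h::complex_inner_space \<Rightarrow> 'h) \<Rightarrow> (real \<Rightarrow> complex) \<Rightarrow> 'h \<Rightarrow> 'h \<Rightarrow> bool" where
  "has_spectral_integral E f x y \<longleftrightarrow>
     (\<exists>s. (\<forall>n. \<forall>(c, a, b)\<in>set (s n). a \<le> b) \<and>
          (\<lambda>n. \<integral>\<^sup>+ t. ennreal ((cmod (f t - step_function (s n) t))\<^sup>2) \<partial>spectral_measure E x)
            \<longlonglongrightarrow> 0 \<and>
          (\<lambda>n. step_integral E x (s n)) \<longlonglongrightarrow> y)"

text \<open>Both notions below are meant for Borel measurable \<open>f\<close>.\<close>

definition fun_domain ::
    "(real \<Rightarrow> 'h::complex_inner_space \<Rightarrow> 'h) \<Rightarrow> (real \<Rightarrow> complex) \<Rightarrow> 'h set" where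
  "fun_domain E f =
     {x. (\<integral>\<^sup>+ t. ennreal ((cmod (f t))\<^sup>2) \<partial>spectral_measure E x) < \<infinity>}"

definition fun_operator ::
    "(real \<Rightarrow> 'h::complex_inner_space \<Rightarrow> 'h) \<Rightarrow> (real \<Rightarrow> complex) \<Rightarrow> 'h \<Rightarrow> 'h" where
  "fun_operator E f x = (THE y. has_spectral_integral E f x y)"

definition partition_of_unity_of ::
    "'h::complex_inner_space set \<Rightarrow> ('h \<Rightarrow> 'h) \<Rightarrow> (real \<Rightarrow> 'h \<Rightarrow> 'h) \<Rightarrow> bool" where
  "partition_of_unity_of D A E \<longleftrightarrow>
     partition_of_unity E \<and> D = fun_domain E complex_of_real \<and>
     (\<forall>x\<in>D. A x = fun_operator E complex_of_real x)"

section \<open>The spectral measure on half-open intervals\<close>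

lemma Re_cinner_projection:
  assumes "orthogonal_projection P"
  shows "Re (cinner (P x) x) = (norm (P x))\<^sup>2"
proof -
  have "cinner (P x) x = cinner (P (P x)) x"
    using assms by (simp add: orthogonal_projection_def)
  also have "\<dots> = cinner (P x) (P x)"
    using assms unfolding orthogonal_projection_def by blast
  finally show ?thesis by (simp add: Re_cinner power2_norm_eq_inner)
qed

lemma norm_projection_le:
  assumes "orthogonal_projection P"
  shows "norm (P x) \<le> norm x"
proof -
  have "norm (P x) * norm (P x) = inner (P x) x"
    using Re_cinner_projection[OF assms, of x] by (simp add: Re_cinner power2_eq_square)
  also have "\<dots> \<le> norm (P x) * norm x" by (rule norm_cauchy_schwarz)
  finally show ?thesis
    by (metis mult_le_cancel_left_pos norm_ge_zero order_le_less)
qed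

lemma spectral_function_mono:
  assumes "partition_of_unity E" "s \<le> t"
  shows "Re (cinner (E s x) x) \<le> Re (cinner (E t x) x)"
proof -
  have proj: "orthogonal_projection (E u)" for u
    using assms(1) by (simp add: partition_of_unity_def)
  have "E s x = E s (E t x)"
    using assms by (simp add: partition_of_unity_def min_def)
  then have "norm (E s x) \<le> norm (E t x)"
    using norm_projection_le[OF proj, of s "E t x"] by simp
  then show ?thesis by (simp add: Re_cinner_projection[OF proj] power_mono)
qed

lemma emeasure_spectral_measure:
  assumes E: "partition_of_unity E" and ab: "a \<le> b"
  shows "emeasure (spectral_measure E x) {a..<b} =
           ennreal (Re (cinner (E b x) x) - Re (cinner (E a x) x))"
proof -
  define G where "G t = - Re (cinner (E (- t) x) x)" for t
  have mono: "G s \<le> G t" if "s \<le> t" for s t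
    using spectral_function_mono[OF E, of "- t" "- s" x] that by (simp add: G_def)
  have cont: "continuous (at_right t) G" for t
  proof -
    have "((\<lambda>s. E s x) \<longlongrightarrow> E (- t) x) (at_left (- t))"
      using E by (simp add: partition_of_unity_def)
    then have "((\<lambda>s. inner (E s x) x) \<longlongrightarrow> inner (E (- t) x) x) (at_left (- t))"
      by (intro tendsto_intros)
    then have "((\<lambda>s. inner (E (- s) x) x) \<longlongrightarrow> inner (E (- t) x) x) (at_right t)"
      by (simp add: at_left_minus filterlim_filtermap)
    then show ?thesis
      unfolding continuous_within G_def Re_cinner by (rule tendsto_minus)
  qed
  have pre: "uminus -` {a..<b} = {- b<..- a}" by auto
  have "emeasure (spectral_measure E x) {a..<b} = emeasure (interval_measure G) {- b<..- a}"
    unfolding spectral_measure_def G_def[abs_def, symmetric]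
    by (subst emeasure_distr) (auto simp: pre)
  also have "\<dots> = ennreal (G (- a) - G (- b))"
    using ab mono cont by (intro emeasure_interval_measure_Ioc) auto
  finally show ?thesis by (simp add: G_def)
qed

end

theory Submission
  imports Defs
begin

text \<open>
  Write \<open>\<mu>\<close> for the spectral measure of a vector \<open>x\<close>, a Borel measure on the line of total mass
  \<open>\<parallel>x\<parallel>\<^sup>2\<close>.  For continuous \<open>f\<close> the functional calculus is isometric: \<open>\<parallel>f(A)x\<parallel>\<^sup>2\<close> is the integral
  of \<open>|f|\<^sup>2\<close> with respect to \<open>\<mu>\<close> (\<open>norm_fun_operator\<close>).  Both parts of the theorem thereby become
  statements about integrals of \<open>|\<phi>|\<^sup>2 = F(|\<psi>|\<^sup>2)\<close> and \<open>|\<psi>|\<^sup>2\<close>.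

  The inequality is Jensen's inequality for the concave function \<open>F\<close> and the probability measure
  \<open>\<mu> / \<parallel>x\<parallel>\<^sup>2\<close> (\<open>fun_operator_concave_inequality\<close>).

  Jensen's inequality is almost an equality when the argument of \<open>F\<close> is almost constant.  A vector
  \<open>y = E\<^sub>t x - E\<^sub>s x\<close> has its spectral measure concentrated on \<open>{s..<t}\<close>
  (\<open>AE_spectral_measure_increment\<close>), so for \<open>0 < s\<close> the monotonicity of \<open>|\<phi>|\<close> and \<open>|\<psi>|\<close> gives
  \<open>\<parallel>\<phi>(A)y\<parallel>\<^sup>2 \<ge> |\<phi>(s)|\<^sup>2 \<parallel>y\<parallel>\<^sup>2\<close> and \<open>\<parallel>\<psi>(A)y\<parallel>\<^sup>2 \<le> |\<psi>(t)|\<^sup>2 \<parallel>y\<parallel>\<^sup>2\<close>.  The ratio of the two sides of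
  the inequality is then at least \<open>|\<phi>(s)|\<^sup>2 / |\<phi>(t)|\<^sup>2\<close>, which tends to \<open>1\<close> as \<open>t\<close> decreases to
  \<open>s\<close>.  The gap hypothesis provides a nonzero \<open>y\<close> for every such \<open>t\<close>; \<open>s = 1\<close> will do.

  The isometry is proved first for step functions, by polarisation: the inner product of the
  increments of \<open>E\<^sub>t x\<close> over two intervals is the \<open>\<mu>\<close>-measure of the intersection of the intervals
  (\<open>cinner_increments\<close>).  It shows that the vector integral does not depend on the approximating
  sequence, and, by completeness, that step integrals converge as soon as the step functions do.
\<close>

section \<open>The complex inner product\<close>

lemma cinner_zero_left: "cinner 0 y = 0"
  using cinner_add_left[of 0 0 y] by simp

lemma scaleC_minus_one: "(- 1) *\<^sub>C x = - x"
  using scaleC_of_real[of "- 1" x] by simp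

lemma scaleC_minus_left: "(- c) *\<^sub>C x = - (c *\<^sub>C x)"
  using scaleC_scaleC[of "- 1" c x] by (simp add: scaleC_minus_one)

lemma cinner_minus_left: "cinner (- x) y = - cinner x y"
  using cinner_scaleC_left[of "- 1" x y] by (simp add: scaleC_minus_one)

lemma cinner_diff_left: "cinner (x - y) z = cinner x z - cinner y z"
  using cinner_add_left[of x "- y" z] by (simp add: cinner_minus_left)

lemma cinner_zero_right: "cinner x 0 = 0"
  by (subst cinner_commute) (simp add: cinner_zero_left)

lemma cinner_add_right: "cinner x (y + z) = cinner x y + cinner x z"
  by (subst (1 2 3) cinner_commute) (simp add: cinner_add_left)

lemma cinner_diff_right: "cinner x (y - z) = cinner x y - cinner x z"
  by (subst (1 2 3) cinner_commute) (simp add: cinner_diff_left)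

lemma cinner_scaleC_right: "cinner x (c *\<^sub>C y) = cnj c * cinner x y"
  by (subst (1 2) cinner_commute) (simp add: cinner_scaleC_left)

lemma cinner_self: "cinner x x = complex_of_real ((norm x)\<^sup>2)"
proof (rule complex_eqI)
  show "Re (cinner x x) = Re (complex_of_real ((norm x)\<^sup>2))"
    by (simp add: Re_cinner power2_norm_eq_inner)
  show "Im (cinner x x) = Im (complex_of_real ((norm x)\<^sup>2))"
    using arg_cong[OF cinner_commute[of x x], of Im] by simp
qed

section \<open>The spectral measure of a vector\<close>

lemma partition_of_unityD:
  assumes "partition_of_unity E"
  shows "orthogonal_projection (E t)"
    and "E u (E v x) = E (min u v) x"
    and "((\<lambda>t. E t x) \<longlongrightarrow> 0) at_bot"
    and "((\<lambda>t. E t x) \<longlongrightarrow> x) at_top"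
  using assms by (simp_all add: partition_of_unity_def)

lemma partition_of_unity_diff:
  assumes "partition_of_unity E"
  shows "E t (x - y) = E t x - E t y"
proof -
  have l: "linear_operator_on UNIV (E t)"
    using partition_of_unityD(1)[OF assms] by (simp add: orthogonal_projection_def)
  then have "E t (x + (- 1) *\<^sub>C y) = E t x + (- 1) *\<^sub>C E t y"
    unfolding linear_operator_on_def by (metis UNIV_I)
  then show ?thesis by (simp add: scaleC_minus_one)
qed

lemma cinner_partition_of_unity:
  assumes "partition_of_unity E"
  shows "cinner (E s x) (E t x) = complex_of_real ((norm (E (min s t) x))\<^sup>2)"
proof -
  have sym: "cinner (E u y) z = cinner y (E u z)" and idem: "E u (E u y) = E u y" for u y z
    using partition_of_unityD(1)[OF assms, of u] by (auto simp: orthogonal_projection_def)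
  have "cinner (E s x) (E t x) = cinner x (E (min s t) x)"
    by (simp add: sym partition_of_unityD(2)[OF assms])
  also have "\<dots> = cinner (E (min s t) x) (E (min s t) x)"
    by (simp add: sym idem)
  finally show ?thesis by (simp add: cinner_self)
qed

lemma sets_spectral_measure [simp, measurable_cong]: "sets (spectral_measure E x) = sets borel"
  by (simp add: spectral_measure_def)

lemma space_spectral_measure [simp]: "space (spectral_measure E x) = UNIV"
  by (simp add: spectral_measure_def)

lemma emeasure_spectral_measure_norm:
  assumes "partition_of_unity E" "a \<le> b"
  shows "emeasure (spectral_measure E x) {a..<b} =
           ennreal ((norm (E b x))\<^sup>2 - (norm (E a x))\<^sup>2)"
  using emeasure_spectral_measure[OF assms]
  by (simp add: Re_cinner_projection partition_of_unityD(1)[OF assms(1)])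

lemma measure_spectral_measure:
  assumes "partition_of_unity E" "a \<le> b"
  shows "measure (spectral_measure E x) {a..<b} = (norm (E b x))\<^sup>2 - (norm (E a x))\<^sup>2"
proof -
  have "(norm (E a x))\<^sup>2 \<le> (norm (E b x))\<^sup>2"
    using spectral_function_mono[OF assms, of x]
    by (simp add: Re_cinner_projection partition_of_unityD(1)[OF assms(1)])
  then show ?thesis
    by (simp add: measure_def emeasure_spectral_measure_norm[OF assms])
qed

lemma emeasure_spectral_measure_UNIV:
  assumes E: "partition_of_unity E"
  shows "emeasure (spectral_measure E x) UNIV = ennreal ((norm x)\<^sup>2)"
proof -
  let ?I = "\<lambda>n::nat. {- real n..<real n}"
  have "(\<Union>n. ?I n) = UNIV"
  proof -
    have "\<exists>n. t \<in> ?I n" for t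
    proof -
      obtain n where "\<bar>t\<bar> < real n" using reals_Archimedean2 by blast
      then have "t \<in> ?I n" by auto
      then show ?thesis ..
    qed
    then show ?thesis by blast
  qed
  moreover have "(\<lambda>n. emeasure (spectral_measure E x) (?I n))
      \<longlonglongrightarrow> emeasure (spectral_measure E x) (\<Union>n. ?I n)"
    by (rule Lim_emeasure_incseq) (auto simp: incseq_def)
  moreover have "(\<lambda>n. emeasure (spectral_measure E x) (?I n)) \<longlonglongrightarrow> ennreal ((norm x)\<^sup>2 - (norm (0::'a))\<^sup>2)"
  proof -
    have top: "(\<lambda>n. E (real n) x) \<longlonglongrightarrow> x"
      using filterlim_compose[OF partition_of_unityD(4)[OF E] filterlim_real_sequentially] .
    have bot: "(\<lambda>n. E (- real n) x) \<longlonglongrightarrow> 0"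
      by (rule filterlim_compose[OF partition_of_unityD(3)[OF E]])
         (simp add: filterlim_uminus_at_bot filterlim_real_sequentially)
    have "(\<lambda>n. (norm (E (real n) x))\<^sup>2 - (norm (E (- real n) x))\<^sup>2)
        \<longlonglongrightarrow> (norm x)\<^sup>2 - (norm (0::'a))\<^sup>2"
      by (intro tendsto_intros top bot)
    then show ?thesis
      by (simp add: emeasure_spectral_measure_norm[OF E])
  qed
  ultimately show ?thesis
    by (metis LIMSEQ_unique norm_zero power_zero_numeral diff_zero)
qed

lemma finite_measure_spectral_measure:
  assumes "partition_of_unity E"
  shows "finite_measure (spectral_measure E x)"
  by (rule finite_measureI) (simp add: emeasure_spectral_measure_UNIV[OF assms])

lemma measure_spectral_measure_UNIV:
  assumes "partition_of_unity E"
  shows "measure (spectral_measure E x) UNIV = (norm x)\<^sup>2"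
  by (simp add: measure_def emeasure_spectral_measure_UNIV[OF assms])

text \<open>
  With \<open>G t = \<parallel>E\<^sub>t x\<parallel>\<^sup>2\<close> the product rule \<open>E\<^sub>u E\<^sub>v = E\<^bsub>min u v\<^esub>\<close> turns the inner product into
  \<open>G (min b d) - G (min b c) - G (min a d) + G (min a c)\<close>.  This is \<open>G (min b d) - G (max a c)\<close> if
  the intervals meet, and \<open>0\<close> otherwise.
\<close>

lemma cinner_increments:
  assumes E: "partition_of_unity E" and ab: "a \<le> b" "c \<le> d"
  shows "cinner (E b x - E a x) (E d x - E c x) =
           complex_of_real (measure (spectral_measure E x) ({a..<b} \<inter> {c..<d}))"
proof (cases "max a c \<le> min b d")
  case True
  then have "measure (spectral_measure E x) ({a..<b} \<inter> {c..<d}) =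
      (norm (E (min b d) x))\<^sup>2 - (norm (E (max a c) x))\<^sup>2"
    by (simp add: Int_atLeastLessThan measure_spectral_measure[OF E])
  then show ?thesis using True ab
    by (auto simp: cinner_diff_left cinner_diff_right cinner_partition_of_unity[OF E] min_def max_def)
next
  case False
  then have "{a..<b} \<inter> {c..<d} = {}" by auto
  then show ?thesis using False ab
    by (auto simp: cinner_diff_left cinner_diff_right cinner_partition_of_unity[OF E] min_def max_def)
qed

section \<open>The isometry for step functions\<close>

abbreviation ordered_steps :: "(complex \<times> real \<times> real) list \<Rightarrow> bool" where
  "ordered_steps ps \<equiv> \<forall>(c, a, b)\<in>set ps. a \<le> b"

lemma step_function_Nil [simp]: "step_function [] t = 0"
  and step_function_Cons:
    "step_function ((c, a, b) # ps) t = c * indicator {a..<b} t + step_function ps t"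
  by (simp_all add: step_function_def)

lemma step_integral_Nil [simp]: "step_integral E x [] = 0"
  and step_integral_Cons:
    "step_integral E x ((c, a, b) # ps) = c *\<^sub>C (E b x - E a x) + step_integral E x ps"
  by (simp_all add: step_integral_def)

lemma step_function_measurable [measurable]: "step_function ps \<in> borel_measurable borel"
proof (induction ps)
  case Nil
  show ?case by (simp add: step_function_def)
next
  case (Cons p ps)
  obtain c a b where p: "p = (c, a, b)" by (cases p) auto
  have "(\<lambda>t. c * indicator {a..<b} t + step_function ps t) \<in> borel_measurable borel"
    using Cons by measurable
  then show ?case by (simp add: p step_function_Cons[abs_def])
qed

text \<open>
  Both sides are sesquilinear in the lists \<open>ps\<close> and \<open>qs\<close>, which reduces the claim to single
  intervals, although the intervals within a list may overlap.
\<close>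

lemma step_integral_cinner:
  assumes E: "partition_of_unity E" and ps: "ordered_steps ps" and qs: "ordered_steps qs"
  shows "has_bochner_integral (spectral_measure E x)
           (\<lambda>t. step_function ps t * cnj (step_function qs t))
           (cinner (step_integral E x ps) (step_integral E x qs))"
  using ps
proof (induction ps)
  case Nil
  show ?case by (simp add: cinner_zero_left has_bochner_integral_zero)
next
  case (Cons p ps)
  obtain c a b where p: "p = (c, a, b)" by (cases p) auto
  have ab: "a \<le> b" using Cons.prems by (simp add: p)
  have "has_bochner_integral (spectral_measure E x)
      (\<lambda>t. c * indicator {a..<b} t * cnj (step_function qs t))
      (cinner (c *\<^sub>C (E b x - E a x)) (step_integral E x qs))"
    using qs
  proof (induction qs)
    case Nil
    show ?case by (simp add: cinner_zero_right has_bochner_integral_zero)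
  next
    case (Cons q qs)
    obtain c' a' b' where q: "q = (c', a', b')" by (cases q) auto
    have ab': "a' \<le> b'" using Cons.prems by (simp add: q)
    interpret finite_measure "spectral_measure E x"
      by (rule finite_measure_spectral_measure[OF E])
    have "has_bochner_integral (spectral_measure E x)
        (\<lambda>t. (c * cnj c') * (indicator ({a..<b} \<inter> {a'..<b'}) t *\<^sub>R 1))
        ((c * cnj c') * (measure (spectral_measure E x) ({a..<b} \<inter> {a'..<b'}) *\<^sub>R 1))"
      by (intro has_bochner_integral_mult_right has_bochner_integral_indicator)
         (auto simp: less_top[symmetric])
    also have "(\<lambda>t. (c * cnj c') * (indicator ({a..<b} \<inter> {a'..<b'}) t *\<^sub>R 1)) =
        (\<lambda>t. c * indicator {a..<b} t * cnj (c' * indicator {a'..<b'} t))"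
      by (auto simp: indicator_def)
    also have "(c * cnj c') * (measure (spectral_measure E x) ({a..<b} \<inter> {a'..<b'}) *\<^sub>R 1) =
        cinner (c *\<^sub>C (E b x - E a x)) (c' *\<^sub>C (E b' x - E a' x))"
      by (simp add: cinner_scaleC_left cinner_scaleC_right cinner_increments[OF E ab ab']
          scaleR_conv_of_real)
    finally have "has_bochner_integral (spectral_measure E x)
        (\<lambda>t. c * indicator {a..<b} t * cnj (c' * indicator {a'..<b'} t))
        (cinner (c *\<^sub>C (E b x - E a x)) (c' *\<^sub>C (E b' x - E a' x)))" .
    moreover have "has_bochner_integral (spectral_measure E x)
        (\<lambda>t. c * indicator {a..<b} t * cnj (step_function qs t))
        (cinner (c *\<^sub>C (E b x - E a x)) (step_integral E x qs))"
      using Cons by simp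
    ultimately show ?case
      using has_bochner_integral_add
      by (fastforce simp: q step_function_Cons step_integral_Cons cinner_add_right distrib_left)
  qed
  moreover have "has_bochner_integral (spectral_measure E x)
      (\<lambda>t. step_function ps t * cnj (step_function qs t))
      (cinner (step_integral E x ps) (step_integral E x qs))"
    using Cons by simp
  ultimately show ?case
    using has_bochner_integral_add
    by (fastforce simp: p step_function_Cons step_integral_Cons cinner_add_left distrib_right)
qed

lemma step_integral_norm:
  assumes "partition_of_unity E" "ordered_steps ps"
  shows "has_bochner_integral (spectral_measure E x) (\<lambda>t. (cmod (step_function ps t))\<^sup>2)
           ((norm (step_integral E x ps))\<^sup>2)"
  using has_bochner_integral_Re[OF step_integral_cinner[OF assms(1,2,2), of x]]
  by (simp add: cinner_self cmod_power2 flip: power2_eq_square)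

lemma step_integral_norm_nn:
  assumes "partition_of_unity E" "ordered_steps ps"
  shows "(\<integral>\<^sup>+ t. ennreal ((cmod (step_function ps t))\<^sup>2) \<partial>spectral_measure E x) =
           ennreal ((norm (step_integral E x ps))\<^sup>2)"
  using step_integral_norm[OF assms, of x]
  by (subst nn_integral_eq_integral) (auto simp: has_bochner_integral_iff)

definition negate_steps :: "(complex \<times> real \<times> real) list \<Rightarrow> (complex \<times> real \<times> real) list" where
  "negate_steps ps = map (\<lambda>(c, a, b). (- c, a, b)) ps"

lemma step_function_diff:
  "step_function (ps @ negate_steps qs) t = step_function ps t - step_function qs t"
proof -
  have "step_function (negate_steps qs) t = - step_function qs t"
    by (induction qs) (auto simp: negate_steps_def step_function_def)
  moreover have "step_function (ps @ rs) t = step_function ps t + step_function rs t" for rs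
    by (simp add: step_function_def)
  ultimately show ?thesis by simp
qed

lemma step_integral_diff:
  "step_integral E x (ps @ negate_steps qs) = step_integral E x ps - step_integral E x qs"
proof -
  have "step_integral E x (negate_steps qs) = - step_integral E x qs"
    by (induction qs) (auto simp: negate_steps_def step_integral_def scaleC_minus_left)
  moreover have "step_integral E x (ps @ rs) = step_integral E x ps + step_integral E x rs" for rs
    by (simp add: step_integral_def)
  ultimately show ?thesis by simp
qed

text \<open>
  The error bound on which uniqueness and convergence of the vector integral rest: step functions
  close to the same \<open>f\<close> in \<open>L\<^sup>2\<close> have close integrals.
\<close>

lemma step_integral_dist:
  assumes E: "partition_of_unity E" and ps: "ordered_steps ps" and qs: "ordered_steps qs"
    and [measurable]: "f \<in> borel_measurable borel"
  shows "ennreal ((norm (step_integral E x ps - step_integral E x qs))\<^sup>2) \<le>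
    2 * (\<integral>\<^sup>+ t. ennreal ((cmod (f t - step_function ps t))\<^sup>2) \<partial>spectral_measure E x) +
    2 * (\<integral>\<^sup>+ t. ennreal ((cmod (f t - step_function qs t))\<^sup>2) \<partial>spectral_measure E x)"
proof -
  have par: "(cmod (u - v))\<^sup>2 \<le> 2 * (cmod (w - u))\<^sup>2 + 2 * (cmod (w - v))\<^sup>2" for u v w
  proof -
    have "cmod (u - v) \<le> cmod (w - u) + cmod (w - v)"
      using norm_triangle_ineq4[of "w - v" "w - u"] by simp
    then have "(cmod (u - v))\<^sup>2 \<le> (cmod (w - u) + cmod (w - v))\<^sup>2"
      by (simp add: power_mono)
    also have "\<dots> \<le> 2 * (cmod (w - u))\<^sup>2 + 2 * (cmod (w - v))\<^sup>2"
      using sum_squares_ge_zero[of "cmod (w - u) - cmod (w - v)" 0]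
      by (simp add: power2_eq_square algebra_simps)
    finally show ?thesis .
  qed
  have "ordered_steps (ps @ negate_steps qs)"
    using ps qs by (auto simp: negate_steps_def)
  then have "ennreal ((norm (step_integral E x ps - step_integral E x qs))\<^sup>2) =
      (\<integral>\<^sup>+ t. ennreal ((cmod (step_function ps t - step_function qs t))\<^sup>2) \<partial>spectral_measure E x)"
    using step_integral_norm_nn[OF E, of "ps @ negate_steps qs" x]
    by (simp add: step_function_diff step_integral_diff)
  also have "\<dots> \<le> (\<integral>\<^sup>+ t. 2 * ennreal ((cmod (f t - step_function ps t))\<^sup>2) +
      2 * ennreal ((cmod (f t - step_function qs t))\<^sup>2) \<partial>spectral_measure E x)"
  proof (rule nn_integral_mono)
    fix t
    have "ennreal ((cmod (step_function ps t - step_function qs t))\<^sup>2) \<le>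
      ennreal (2 * (cmod (f t - step_function ps t))\<^sup>2 + 2 * (cmod (f t - step_function qs t))\<^sup>2)"
      by (intro ennreal_leI par)
    then show "ennreal ((cmod (step_function ps t - step_function qs t))\<^sup>2) \<le>
      2 * ennreal ((cmod (f t - step_function ps t))\<^sup>2) + 2 * ennreal ((cmod (f t - step_function qs t))\<^sup>2)"
      by (simp add: ennreal_mult')
  qed
  also have "\<dots> = 2 * (\<integral>\<^sup>+ t. ennreal ((cmod (f t - step_function ps t))\<^sup>2) \<partial>spectral_measure E x) +
    2 * (\<integral>\<^sup>+ t. ennreal ((cmod (f t - step_function qs t))\<^sup>2) \<partial>spectral_measure E x)"
    by (subst nn_integral_add) (simp_all add: nn_integral_cmult)
  finally show ?thesis .
qed

section \<open>The functional calculus of continuous functions\<close>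

lemma has_spectral_integral_unique:
  assumes E: "partition_of_unity E" and f: "f \<in> borel_measurable borel"
    and "has_spectral_integral E f x y" "has_spectral_integral E f x z"
  shows "y = z"
proof -
  let ?e = "\<lambda>s n. \<integral>\<^sup>+ t. ennreal ((cmod (f t - step_function (s n) t))\<^sup>2) \<partial>spectral_measure E x"
  obtain r where r: "\<And>n. ordered_steps (r n)" "?e r \<longlonglongrightarrow> 0" "(\<lambda>n. step_integral E x (r n)) \<longlonglongrightarrow> y"
    using assms(3) unfolding has_spectral_integral_def by blast
  obtain s where s: "\<And>n. ordered_steps (s n)" "?e s \<longlonglongrightarrow> 0" "(\<lambda>n. step_integral E x (s n)) \<longlonglongrightarrow> z"
    using assms(4) unfolding has_spectral_integral_def by blast
  have "(\<lambda>n. 2 * ?e r n + 2 * ?e s n) \<longlonglongrightarrow> 2 * 0 + 2 * 0"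
    by (intro tendsto_add ennreal_tendsto_cmult r s) simp_all
  moreover have "(\<lambda>n. ennreal ((norm (step_integral E x (r n) - step_integral E x (s n)))\<^sup>2))
      \<longlonglongrightarrow> ennreal ((norm (y - z))\<^sup>2)"
    by (intro tendsto_ennrealI tendsto_intros r s)
  ultimately have "ennreal ((norm (y - z))\<^sup>2) \<le> 2 * 0 + 2 * 0"
    by (intro LIMSEQ_le) (use step_integral_dist[OF E r(1) s(1) f, of x] in blast)+
  then show ?thesis by (simp add: ennreal_eq_0_iff)
qed

text \<open>
  The step function takes the value of \<open>f\<close> at the left endpoint of each of the \<open>N\<close> grid intervals
  of length \<open>h\<close>.
\<close>

lemma step_approximation_grid:
  fixes f :: "real \<Rightarrow> complex"
  assumes "0 \<le> h"
    and "\<And>t u. t \<in> {a..a + real N * h} \<Longrightarrow> u \<in> {a..a + real N * h} \<Longrightarrow> \<bar>t - u\<bar> \<le> h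
           \<Longrightarrow> cmod (f t - f u) \<le> e"
  shows "\<exists>ps. ordered_steps ps \<and>
           (\<forall>t\<in>{a..<a + real N * h}. cmod (f t - step_function ps t) \<le> e) \<and>
           (\<forall>t. t \<notin> {a..<a + real N * h} \<longrightarrow> step_function ps t = 0)"
  using assms(2)
proof (induction N)
  case 0
  then show ?case by (intro exI[of _ "[]"]) simp
next
  case (Suc N)
  define m where "m = a + real N * h"
  have m: "a \<le> m" "a + real (Suc N) * h = m + h"
    using assms(1) by (simp_all add: m_def algebra_simps)
  obtain ps where ps: "ordered_steps ps"
      "\<And>t. t \<in> {a..<m} \<Longrightarrow> cmod (f t - step_function ps t) \<le> e"
      "\<And>t. t \<notin> {a..<m} \<Longrightarrow> step_function ps t = 0"
    using Suc.IH Suc.prems assms(1) unfolding m(2) m_def[symmetric] by force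
  have last: "cmod (f t - f m) \<le> e" if "t \<in> {m..<m + h}" for t
    using Suc.prems[of t m] that m assms(1) by simp
  show ?case unfolding m(2)
  proof (intro exI[of _ "(f m, m, m + h) # ps"] conjI ballI allI impI)
    fix t assume t: "t \<in> {a..<m + h}"
    show "cmod (f t - step_function ((f m, m, m + h) # ps) t) \<le> e"
    proof (cases "t < m")
      case True
      then show ?thesis using ps(2)[of t] t by (simp add: step_function_Cons)
    next
      case False
      then show ?thesis using ps(3)[of t] last[of t] t by (simp add: step_function_Cons)
    qed
  qed (use ps m assms(1) in \<open>auto simp: step_function_Cons\<close>)
qed

lemma step_approximation:
  fixes f :: "real \<Rightarrow> complex"
  assumes f: "continuous_on UNIV f" and e: "0 < e" and R: "0 \<le> R"
  obtains ps where "ordered_steps ps"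
    and "\<And>t. t \<in> {- R..<R} \<Longrightarrow> cmod (f t - step_function ps t) \<le> e"
    and "\<And>t. t \<notin> {- R..<R} \<Longrightarrow> step_function ps t = 0"
proof -
  have "uniformly_continuous_on {- R..R} f"
    by (intro compact_uniformly_continuous continuous_on_subset[OF f]) auto
  then obtain d where d: "0 < d"
      "\<And>t u. t \<in> {- R..R} \<Longrightarrow> u \<in> {- R..R} \<Longrightarrow> dist t u < d \<Longrightarrow> dist (f t) (f u) < e"
    using e unfolding uniformly_continuous_on_def by metis
  obtain N where N: "2 * R / d < real N" using reals_Archimedean2 by blast
  have N0: "0 < real N" using N R d(1) by (smt (verit) divide_nonneg_pos)
  define h where "h = 2 * R / real N"
  have h: "0 \<le> h" "h < d" "- R + real N * h = R"
    using N N0 R d(1) by (simp_all add: h_def field_simps)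
  have "cmod (f t - f u) \<le> e"
    if "t \<in> {- R..R}" "u \<in> {- R..R}" "\<bar>t - u\<bar> \<le> h" for t u
    using d(2)[of t u] that h(2) by (simp add: dist_norm)
  then show ?thesis
    using step_approximation_grid[of h "- R" N f e] h that by auto
qed

text \<open>
  The step functions that approximate \<open>f\<close> to within \<open>1 / (n + 1)\<close> on \<open>{- n..<n}\<close> and vanish
  elsewhere converge to \<open>f\<close> pointwise, with errors of modulus at most \<open>|f| + 1\<close>.  Since \<open>\<mu>\<close> is
  finite, dominated convergence yields convergence in \<open>L\<^sup>2\<close> as well as convergence of the norms.
\<close>

lemma has_spectral_integral_norm:
  fixes E :: "real \<Rightarrow> 'h::complex_hilbert_space \<Rightarrow> 'h"
  assumes E: "partition_of_unity E" and f: "continuous_on UNIV f" and x: "x \<in> fun_domain E f"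
  shows "\<exists>y. has_spectral_integral E f x y \<and>
           (norm y)\<^sup>2 = (LINT t|spectral_measure E x. (cmod (f t))\<^sup>2)"
proof -
  let ?M = "spectral_measure E x"
  interpret finite_measure ?M by (rule finite_measure_spectral_measure[OF E])
  have fm [measurable]: "f \<in> borel_measurable borel"
    using f by (rule borel_measurable_continuous_onI)
  have intf: "integrable ?M (\<lambda>t. (cmod (f t))\<^sup>2)"
    using x by (intro integrableI_nonneg) (auto simp: fun_domain_def)
  have "\<exists>ps. ordered_steps ps \<and>
      (\<forall>t\<in>{- real n..<real n}. cmod (f t - step_function ps t) \<le> 1 / Suc n) \<and>
      (\<forall>t. t \<notin> {- real n..<real n} \<longrightarrow> step_function ps t = 0)" for n
    by (rule step_approximation[OF f, of "1 / Suc n" "real n"]) auto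
  then obtain s where s: "\<And>n. ordered_steps (s n)"
      "\<And>n t. t \<in> {- real n..<real n} \<Longrightarrow> cmod (f t - step_function (s n) t) \<le> 1 / Suc n"
      "\<And>n t. t \<notin> {- real n..<real n} \<Longrightarrow> step_function (s n) t = 0"
    by metis
  have lim: "(\<lambda>n. step_function (s n) t) \<longlonglongrightarrow> f t" for t
  proof -
    obtain N where N: "\<bar>t\<bar> < real N" using reals_Archimedean2 by blast
    have "(\<lambda>n. f t - step_function (s n) t) \<longlonglongrightarrow> 0"
    proof (rule Lim_null_comparison[OF _ LIMSEQ_inverse_real_of_nat])
      show "\<forall>\<^sub>F n in sequentially. cmod (f t - step_function (s n) t) \<le> inverse (real (Suc n))"
        using eventually_ge_at_top[of N]
      proof eventually_elim
        case (elim n)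
        then have "t \<in> {- real n..<real n}" using N by auto
        then show ?case using s(2)[of t n] by (simp add: inverse_eq_divide)
      qed
    qed
    from tendsto_diff[OF tendsto_const[of "f t"] this] show ?thesis by simp
  qed
  have err: "cmod (f t - step_function (s n) t) \<le> cmod (f t) + 1" for n t
  proof (cases "t \<in> {- real n..<real n}")
    case True
    have "1 / Suc n \<le> (1::real)" by simp
    then show ?thesis using s(2)[OF True] norm_ge_zero[of "f t"] by linarith
  qed (simp add: s(3))
  have bnd: "cmod (step_function (s n) t) \<le> 2 * cmod (f t) + 1" for n t
    using err[of t n] norm_triangle_ineq4[of "f t" "f t - step_function (s n) t"] by simp
  \<comment> \<open>A common dominating function for the squares of the errors and of the step functions; the
    constants come from \<open>(2 r + 1)\<^sup>2 \<le> 8 r\<^sup>2 + 2\<close>.\<close>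
  define w where "w t = 8 * (cmod (f t))\<^sup>2 + 2" for t
  have sq: "r\<^sup>2 \<le> w t" if "0 \<le> r" "r \<le> 2 * cmod (f t) + 1" for r t
  proof -
    have "r\<^sup>2 \<le> (2 * cmod (f t) + 1)\<^sup>2" using that by (simp add: power_mono)
    also have "\<dots> \<le> w t"
      using sum_squares_ge_zero[of "2 * cmod (f t) - 1" 0]
      by (simp add: w_def power2_eq_square algebra_simps)
    finally show ?thesis .
  qed
  have wint: "integrable ?M w" unfolding w_def using intf by simp
  have wm [measurable]: "w \<in> borel_measurable borel" unfolding w_def by measurable
  have norms: "(\<lambda>n. LINT t|?M. (cmod (step_function (s n) t))\<^sup>2) \<longlonglongrightarrow> (LINT t|?M. (cmod (f t))\<^sup>2)"
    by (rule integral_dominated_convergence[where w = w])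
       (use wint sq[OF _ bnd] in \<open>auto intro!: tendsto_intros lim\<close>)
  have err0: "(\<lambda>n. \<integral>\<^sup>+ t. ennreal ((cmod (f t - step_function (s n) t))\<^sup>2) \<partial>?M) \<longlonglongrightarrow> 0"
  proof -
    have "(\<lambda>n. \<integral>\<^sup>+ t. ennreal ((cmod (f t - step_function (s n) t))\<^sup>2) \<partial>?M)
        \<longlonglongrightarrow> (\<integral>\<^sup>+ t. 0 \<partial>?M)"
    proof (rule nn_integral_dominated_convergence[where w = "\<lambda>t. ennreal (w t)"])
      show "AE t in ?M. ennreal ((cmod (f t - step_function (s n) t))\<^sup>2) \<le> ennreal (w t)" for n
      proof (rule AE_I2)
        fix t
        have "cmod (f t - step_function (s n) t) \<le> 2 * cmod (f t) + 1"
          using err[of t n] norm_ge_zero[of "f t"] by linarith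
        then show "ennreal ((cmod (f t - step_function (s n) t))\<^sup>2) \<le> ennreal (w t)"
          by (intro ennreal_leI sq) auto
      qed
      show "(\<integral>\<^sup>+ t. ennreal (w t) \<partial>?M) < \<infinity>"
        using wint by (subst nn_integral_eq_integral) (auto simp: w_def)
      show "AE t in ?M. (\<lambda>n. ennreal ((cmod (f t - step_function (s n) t))\<^sup>2)) \<longlonglongrightarrow> 0"
      proof (rule AE_I2)
        fix t
        have "(\<lambda>n. ennreal ((cmod (f t - step_function (s n) t))\<^sup>2))
            \<longlonglongrightarrow> ennreal ((cmod (f t - f t))\<^sup>2)"
          by (intro tendsto_ennrealI tendsto_intros lim)
        then show "(\<lambda>n. ennreal ((cmod (f t - step_function (s n) t))\<^sup>2)) \<longlonglongrightarrow> 0" by simp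
      qed
    qed auto
    then show ?thesis by simp
  qed
  have "Cauchy (\<lambda>n. step_integral E x (s n))"
  proof (rule metric_CauchyI)
    fix e :: real assume e: "0 < e"
    have "\<forall>\<^sub>F n in sequentially.
        (\<integral>\<^sup>+ t. ennreal ((cmod (f t - step_function (s n) t))\<^sup>2) \<partial>?M) < ennreal (e\<^sup>2 / 4)"
      using e by (intro order_tendstoD(2)[OF err0]) simp
    then obtain N where N: "\<And>n. n \<ge> N \<Longrightarrow>
        (\<integral>\<^sup>+ t. ennreal ((cmod (f t - step_function (s n) t))\<^sup>2) \<partial>?M) < ennreal (e\<^sup>2 / 4)"
      unfolding eventually_sequentially by blast
    show "\<exists>N. \<forall>m\<ge>N. \<forall>n\<ge>N. dist (step_integral E x (s m)) (step_integral E x (s n)) < e"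
    proof (intro exI[of _ N] allI impI)
      fix m n assume mn: "N \<le> m" "N \<le> n"
      let ?r = "\<lambda>k. \<integral>\<^sup>+ t. ennreal ((cmod (f t - step_function (s k) t))\<^sup>2) \<partial>?M"
      have "ennreal ((norm (step_integral E x (s m) - step_integral E x (s n)))\<^sup>2)
          \<le> 2 * ?r m + 2 * ?r n"
        by (rule step_integral_dist[OF E s(1) s(1) fm])
      also have "\<dots> < ennreal (e\<^sup>2 / 2 + e\<^sup>2 / 2)"
      proof (rule add_mono_ennreal)
        have "2 * ?r k < ennreal (e\<^sup>2 / 2)" if "N \<le> k" for k
        proof -
          have "2 * ?r k < 2 * ennreal (e\<^sup>2 / 4)"
            by (intro ennreal_mult_strict_left_mono N that) simp_all
          also have "\<dots> = ennreal (2 * (e\<^sup>2 / 4))" by (subst ennreal_mult') simp_all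
          finally show ?thesis by simp
        qed
        then show "2 * ?r m < ennreal (e\<^sup>2 / 2)" "2 * ?r n < ennreal (e\<^sup>2 / 2)"
          using mn by auto
      qed
      finally have "(norm (step_integral E x (s m) - step_integral E x (s n)))\<^sup>2 < e\<^sup>2"
        by (simp add: ennreal_less_iff)
      then show "dist (step_integral E x (s m)) (step_integral E x (s n)) < e"
        using e by (simp add: dist_norm power_less_imp_less_base)
    qed
  qed
  then obtain y where y: "(\<lambda>n. step_integral E x (s n)) \<longlonglongrightarrow> y"
    using Cauchy_convergent convergent_def by blast
  have "(\<lambda>n. (norm (step_integral E x (s n)))\<^sup>2) \<longlonglongrightarrow> (norm y)\<^sup>2"
    by (intro tendsto_intros y)
  moreover have "(norm (step_integral E x (s n)))\<^sup>2 = (LINT t|?M. (cmod (step_function (s n) t))\<^sup>2)" for n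
    using has_bochner_integral_integral_eq[OF step_integral_norm[OF E s(1)]] by simp
  ultimately have "(norm y)\<^sup>2 = (LINT t|?M. (cmod (f t))\<^sup>2)"
    using norms LIMSEQ_unique by simp
  moreover have "has_spectral_integral E f x y"
    unfolding has_spectral_integral_def using s(1) err0 y by blast
  ultimately show ?thesis by blast
qed

lemma norm_fun_operator:
  fixes E :: "real \<Rightarrow> 'h::complex_hilbert_space \<Rightarrow> 'h"
  assumes E: "partition_of_unity E" and f: "continuous_on UNIV f" and x: "x \<in> fun_domain E f"
  shows "(norm (fun_operator E f x))\<^sup>2 = (LINT t|spectral_measure E x. (cmod (f t))\<^sup>2)"
proof -
  obtain y where y: "has_spectral_integral E f x y"
      "(norm y)\<^sup>2 = (LINT t|spectral_measure E x. (cmod (f t))\<^sup>2)"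
    using has_spectral_integral_norm[OF assms] by blast
  have "fun_operator E f x = y"
    unfolding fun_operator_def using y(1)
    by (intro the_equality has_spectral_integral_unique[OF E borel_measurable_continuous_onI[OF f]])
  then show ?thesis by (simp add: y(2))
qed

lemma fun_domain_iff_integrable:
  assumes "continuous_on UNIV f"
  shows "x \<in> fun_domain E f \<longleftrightarrow> integrable (spectral_measure E x) (\<lambda>t. (cmod (f t))\<^sup>2)"
proof -
  have [measurable]: "f \<in> borel_measurable borel"
    using assms by (rule borel_measurable_continuous_onI)
  show ?thesis by (simp add: fun_domain_def integrable_iff_bounded)
qed

section \<open>Jensen's inequality\<close>

text \<open>
  The point \<open>m\<close> has to be interior: at \<open>0\<close> the graph may have a vertical tangent, as for the square
  root.
\<close>

lemma concave_supporting_line: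
  fixes F :: "real \<Rightarrow> real"
  assumes "concave_on {0..} F" "0 < m"
  obtains k where "\<And>u. 0 \<le> u \<Longrightarrow> F u \<le> F m + k * (u - m)"
proof -
  have "convex_on {0..} (\<lambda>u. - F u)" using assms(1) by (simp add: concave_on_def)
  from convex_le_Inf_differential[OF this, of m] assms(2)
  obtain k where "\<And>u. 0 \<le> u \<Longrightarrow> - F u \<ge> - F m + k * (u - m)"
    by (fastforce simp: interior_real_atLeast)
  then have "F u \<le> F m + (- k) * (u - m)" if "0 \<le> u" for u using that by fastforce
  then show ?thesis using that by blast
qed

text \<open>
  Integrate the supporting line of \<open>F\<close> at the mean \<open>m\<close> of \<open>g\<close>.  The same line dominates
  \<open>F \<circ> g\<close>, which gives its integrability.  If \<open>m = 0\<close> there may be no such line, but then \<open>g\<close>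
  vanishes almost everywhere and \<open>F 0 = 0\<close> suffices.
\<close>

lemma concave_Jensen_halfline:
  fixes F g :: "real \<Rightarrow> real"
  assumes M: "finite_measure M" "0 < measure M (space M)"
    and F: "concave_on {0..} F" "\<And>u. 0 \<le> u \<Longrightarrow> 0 \<le> F u" "F 0 = 0"
    and g: "integrable M g" "\<And>t. 0 \<le> g t" and Fg: "(\<lambda>t. F (g t)) \<in> borel_measurable M"
  shows "integrable M (\<lambda>t. F (g t))"
    and "(LINT t|M. F (g t)) \<le> measure M (space M) * F ((LINT t|M. g t) / measure M (space M))"
proof -
  interpret finite_measure M by (rule M(1))
  define \<mu> where "\<mu> = measure M (space M)"
  define m where "m = (LINT t|M. g t) / \<mu>"
  have \<mu>: "0 < \<mu>" using M(2) by (simp add: \<mu>_def)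
  have "integrable M (\<lambda>t. F (g t)) \<and> (LINT t|M. F (g t)) \<le> \<mu> * F m"
  proof (cases "m = 0")
    case True
    then have "(LINT t|M. g t) = 0" using \<mu> by (simp add: m_def)
    then have "AE t in M. g t = 0"
      using integral_nonneg_eq_0_iff_AE[OF g(1)] g(2) by simp
    then have "AE t in M. F (g t) = 0" by eventually_elim (simp add: F(3))
    then show ?thesis
      using Fg True F(3) integral_cong_AE[of "\<lambda>t. F (g t)" M "\<lambda>_. 0"]
        integrable_cong_AE[of "\<lambda>t. F (g t)" M "\<lambda>_. 0"] by simp
  next
    case False
    have "0 \<le> m" using \<mu> g(2) by (simp add: m_def)
    with False have "0 < m" by simp
    then obtain k where k: "\<And>u. 0 \<le> u \<Longrightarrow> F u \<le> F m + k * (u - m)"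
      using concave_supporting_line[OF F(1)] by blast
    have line: "integrable M (\<lambda>t. F m + k * (g t - m))" using g(1) by simp
    then have int: "integrable M (\<lambda>t. F (g t))"
      using F(2)[OF g(2)] k[OF g(2)] Fg
      by (elim Bochner_Integration.integrable_bound) (auto intro!: AE_I2 simp: order_trans[OF _ abs_ge_self])
    have "(LINT t|M. F (g t)) \<le> (LINT t|M. F m + k * (g t - m))"
      using int line k[OF g(2)] by (intro integral_mono) auto
    also have "\<dots> = \<mu> * F m + k * ((LINT t|M. g t) - \<mu> * m)"
      using g(1) by (simp add: \<mu>_def algebra_simps)
    also have "\<dots> = \<mu> * F m" using \<mu> by (simp add: m_def)
    finally show ?thesis using int by simp
  qed
  then show "integrable M (\<lambda>t. F (g t))"
    and "(LINT t|M. F (g t)) \<le> measure M (space M) * F ((LINT t|M. g t) / measure M (space M))"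
    by (simp_all add: \<mu>_def m_def)
qed

lemma fun_operator_concave_inequality:
  fixes E :: "real \<Rightarrow> 'h::complex_hilbert_space \<Rightarrow> 'h"
  assumes E: "partition_of_unity E"
    and \<phi>: "continuous_on UNIV \<phi>" and \<psi>: "continuous_on UNIV \<psi>"
    and F: "concave_on {0..} F" "\<And>u. 0 \<le> u \<Longrightarrow> 0 \<le> F u" "F 0 = 0"
    and \<phi>\<psi>: "\<And>t. (cmod (\<phi> t))\<^sup>2 = F ((cmod (\<psi> t))\<^sup>2)"
    and x: "x \<in> fun_domain E \<psi>" "x \<noteq> 0"
  shows "x \<in> fun_domain E \<phi>"
    and "(norm (fun_operator E \<phi> x))\<^sup>2
           \<le> (norm x)\<^sup>2 * F ((norm (fun_operator E \<psi> x))\<^sup>2 / (norm x)\<^sup>2)"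
proof -
  have [measurable]: "\<phi> \<in> borel_measurable borel"
    using \<phi> by (rule borel_measurable_continuous_onI)
  have "integrable (spectral_measure E x) (\<lambda>t. (cmod (\<psi> t))\<^sup>2)"
    using x(1) by (simp add: fun_domain_iff_integrable[OF \<psi>])
  moreover have "(\<lambda>t. F ((cmod (\<psi> t))\<^sup>2)) \<in> borel_measurable (spectral_measure E x)"
    unfolding \<phi>\<psi>[symmetric] by measurable
  moreover have "0 < measure (spectral_measure E x) (space (spectral_measure E x))"
    using x(2) by (simp add: measure_spectral_measure_UNIV[OF E])
  ultimately have "integrable (spectral_measure E x) (\<lambda>t. (cmod (\<phi> t))\<^sup>2)"
    and le: "(LINT t|spectral_measure E x. (cmod (\<phi> t))\<^sup>2)
      \<le> (norm x)\<^sup>2 * F ((LINT t|spectral_measure E x. (cmod (\<psi> t))\<^sup>2) / (norm x)\<^sup>2)"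
    using concave_Jensen_halfline[OF finite_measure_spectral_measure[OF E] _ F,
        of x "\<lambda>t. (cmod (\<psi> t))\<^sup>2"]
    unfolding \<phi>\<psi> space_spectral_measure measure_spectral_measure_UNIV[OF E]
    by (blast intro: zero_le_power2)+
  then show dom: "x \<in> fun_domain E \<phi>" by (simp add: fun_domain_iff_integrable[OF \<phi>])
  show "(norm (fun_operator E \<phi> x))\<^sup>2
      \<le> (norm x)\<^sup>2 * F ((norm (fun_operator E \<psi> x))\<^sup>2 / (norm x)\<^sup>2)"
    using le by (simp add: norm_fun_operator[OF E \<phi> dom] norm_fun_operator[OF E \<psi> x(1)])
qed

section \<open>Vectors with localised spectral measure\<close>

text \<open>
  The vector \<open>y\<close> is fixed by \<open>E\<^sub>t\<close> and annihilated by \<open>E\<^sub>s\<close>, so \<open>{s..<t}\<close> carries the whole mass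
  \<open>\<parallel>y\<parallel>\<^sup>2\<close> of its spectral measure.
\<close>

lemma AE_spectral_measure_increment:
  assumes E: "partition_of_unity E" and st: "s \<le> t" and y: "y = E t x - E s x"
  shows "AE u in spectral_measure E y. u \<in> {s..<t}"
proof -
  interpret finite_measure "spectral_measure E y"
    by (rule finite_measure_spectral_measure[OF E])
  have "E t y = y" "E s y = 0"
    using st by (simp_all add: y partition_of_unity_diff[OF E] partition_of_unityD(2)[OF E] min_def)
  then have "measure (spectral_measure E y) {s..<t} = measure (spectral_measure E y) UNIV"
    by (simp add: measure_spectral_measure[OF E st] measure_spectral_measure_UNIV[OF E])
  then have "measure (spectral_measure E y) (space (spectral_measure E y) - {s..<t}) = 0"
    by (subst finite_measure_compl) auto
  then show ?thesis
    by (intro AE_I[of _ _ "- {s..<t}"]) (auto simp: emeasure_eq_measure Compl_eq_Diff_UNIV)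
qed

lemma norm_fun_operator_increment_bounds:
  fixes E :: "real \<Rightarrow> 'h::complex_hilbert_space \<Rightarrow> 'h"
  assumes E: "partition_of_unity E" and st: "s \<le> t" and y: "y = E t x - E s x"
    and f: "continuous_on UNIV f"
    and bounds: "\<And>u. u \<in> {s..<t} \<Longrightarrow> a \<le> (cmod (f u))\<^sup>2"
      "\<And>u. u \<in> {s..<t} \<Longrightarrow> (cmod (f u))\<^sup>2 \<le> b"
  shows "y \<in> fun_domain E f"
    and "a * (norm y)\<^sup>2 \<le> (norm (fun_operator E f y))\<^sup>2"
    and "(norm (fun_operator E f y))\<^sup>2 \<le> b * (norm y)\<^sup>2"
proof -
  let ?M = "spectral_measure E y"
  interpret finite_measure ?M by (rule finite_measure_spectral_measure[OF E])
  have [measurable]: "f \<in> borel_measurable borel"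
    using f by (rule borel_measurable_continuous_onI)
  have AE: "AE u in ?M. u \<in> {s..<t}" by (rule AE_spectral_measure_increment[OF E st y])
  have int: "integrable ?M (\<lambda>u. (cmod (f u))\<^sup>2)"
  proof (rule integrable_const_bound[where B = b])
    show "AE u in ?M. norm ((cmod (f u))\<^sup>2) \<le> b"
      using AE by eventually_elim (use bounds(2) in simp)
  qed measurable
  then show dom: "y \<in> fun_domain E f" by (simp add: fun_domain_iff_integrable[OF f])
  have "(LINT u|?M. a) \<le> (LINT u|?M. (cmod (f u))\<^sup>2)"
    by (rule integral_mono_AE[OF _ int]) (simp, use AE in eventually_elim, use bounds(1) in simp)
  then show "a * (norm y)\<^sup>2 \<le> (norm (fun_operator E f y))\<^sup>2"
    by (simp add: norm_fun_operator[OF E f dom] measure_spectral_measure_UNIV[OF E] mult.commute)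
  have "(LINT u|?M. (cmod (f u))\<^sup>2) \<le> (LINT u|?M. b)"
    by (rule integral_mono_AE[OF int]) (simp, use AE in eventually_elim, use bounds(2) in simp)
  then show "(norm (fun_operator E f y))\<^sup>2 \<le> b * (norm y)\<^sup>2"
    by (simp add: norm_fun_operator[OF E f dom] measure_spectral_measure_UNIV[OF E] mult.commute)
qed

text \<open>
  Function domains are therefore nonempty, so an image of one that differs from \<open>{0}\<close> contains a
  nonzero vector.
\<close>

lemma zero_in_fun_domain:
  assumes E: "partition_of_unity E"
  shows "0 \<in> fun_domain E f"
proof -
  have "UNIV \<in> null_sets (spectral_measure E 0)"
    by (simp add: null_sets_def emeasure_spectral_measure_UNIV[OF E])
  from nn_integral_null_set[OF this] show ?thesis by (simp add: fun_domain_def)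
qed

section \<open>The sharp inequality\<close>

theorem theorem3:
  fixes D :: "'h::complex_hilbert_space set"
    and A :: "'h \<Rightarrow> 'h"
    and E :: "real \<Rightarrow> 'h \<Rightarrow> 'h"
    and \<phi> \<psi> :: "real \<Rightarrow> complex"
    and F :: "real \<Rightarrow> real"
  assumes "self_adjoint_operator D A"
    and "\<not> bounded_operator_on D A"
    and "partition_of_unity_of D A E"
    and "continuous_on UNIV \<phi>" and "continuous_on UNIV \<psi>"
    and "\<And>t. cmod (\<phi> (- t)) = cmod (\<phi> t)"
    and "\<And>t. cmod (\<psi> (- t)) = cmod (\<psi> t)"
    and "strict_mono_on {0<..} (\<lambda>t. cmod (\<phi> t))"
    and "strict_mono_on {0<..} (\<lambda>t. cmod (\<psi> t))"
    and "\<And>u. 0 \<le> u \<Longrightarrow> 0 \<le> F u"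
    and "strict_mono_on {0..} F"
    and "concave_on {0..} F"
    and "F 0 = 0"
    and "\<And>t. (cmod (\<phi> t))\<^sup>2 = F ((cmod (\<psi> t))\<^sup>2)"
  shows "(\<forall>x\<in>fun_domain E \<psi>. x \<noteq> 0 \<longrightarrow>
            x \<in> fun_domain E \<phi> \<and>
            (norm (fun_operator E \<phi> x))\<^sup>2
              \<le> (norm x)\<^sup>2 * F ((norm (fun_operator E \<psi> x))\<^sup>2 / (norm x)\<^sup>2)) \<and>
         ((\<forall>s t :: ereal. 0 \<le> s \<and> s < t \<and> t \<le> \<infinity> \<longrightarrow>
             (\<lambda>x. extended_family E t x - extended_family E s x) ` fun_domain E \<psi> \<noteq> {0}) \<longrightarrow>
          (\<forall>c<1. \<exists>x\<in>fun_domain E \<psi>. x \<noteq> 0 \<and>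
             (norm (fun_operator E \<phi> x))\<^sup>2
               > c * (norm x)\<^sup>2 * F ((norm (fun_operator E \<psi> x))\<^sup>2 / (norm x)\<^sup>2)))"
proof (intro conjI ballI impI allI)
  have E: "partition_of_unity E" using assms(3) by (simp add: partition_of_unity_of_def)
  note ineq = fun_operator_concave_inequality[OF E assms(4,5,12,10,13,14)]
  {
    fix x assume x: "x \<in> fun_domain E \<psi>" "x \<noteq> 0"
    show "x \<in> fun_domain E \<phi>" by (rule ineq(1)[OF _ x])
    show "(norm (fun_operator E \<phi> x))\<^sup>2
        \<le> (norm x)\<^sup>2 * F ((norm (fun_operator E \<psi> x))\<^sup>2 / (norm x)\<^sup>2)"
      by (rule ineq(2)[OF _ x])
  }
  fix c :: real
  assume gaps: "\<forall>s t :: ereal. 0 \<le> s \<and> s < t \<and> t \<le> \<infinity> \<longrightarrow>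
      (\<lambda>x. extended_family E t x - extended_family E s x) ` fun_domain E \<psi> \<noteq> {0}"
    and c: "c < 1"
  have mono: "\<And>r s. 0 < r \<Longrightarrow> r < s \<Longrightarrow> cmod (\<phi> r) < cmod (\<phi> s)"
      "\<And>r s. 0 < r \<Longrightarrow> r < s \<Longrightarrow> cmod (\<psi> r) < cmod (\<psi> s)"
    using assms(8,9) by (auto simp: strict_mono_on_def)
  \<comment> \<open>Replacing \<open>c\<close> by a nonnegative \<open>d\<close> lets an upper bound for \<open>F ?q\<close> bound \<open>d * F ?q\<close>.\<close>
  define d where "d = max c 0"
  have d: "0 \<le> d" "d < 1" "c \<le> d" using c by (auto simp: d_def)
  have "0 < cmod (\<phi> 1)"
    by (rule le_less_trans[OF norm_ge_zero mono(1)[of "1/2" 1]]) simp_all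
  then have \<phi>1: "0 < (cmod (\<phi> 1))\<^sup>2" by simp
  \<comment> \<open>The interval \<open>{1..<t}\<close> is chosen so short that the factor by which \<open>|\<phi>|\<^sup>2\<close> grows on it
    remains less than \<open>1\<close> after multiplication by \<open>d\<close>.\<close>
  have "((\<lambda>t. d * (cmod (\<phi> t))\<^sup>2) \<longlongrightarrow> d * (cmod (\<phi> 1))\<^sup>2) (at_right 1)"
    using assms(4) by (intro tendsto_intros) (auto simp: continuous_on_def intro: tendsto_mono[OF at_le])
  then have "\<forall>\<^sub>F t in at_right 1. d * (cmod (\<phi> t))\<^sup>2 < (cmod (\<phi> 1))\<^sup>2"
    by (rule order_tendstoD(2)) (use d \<phi>1 in simp)
  then have "\<forall>\<^sub>F t in at_right 1. d * (cmod (\<phi> t))\<^sup>2 < (cmod (\<phi> 1))\<^sup>2 \<and> 1 < t"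
    using eventually_at_right_less[of "1::real"] by eventually_elim simp
  then obtain t where t: "d * (cmod (\<phi> t))\<^sup>2 < (cmod (\<phi> 1))\<^sup>2" "1 < t"
    using eventually_happens'[OF trivial_limit_at_right_real] by blast
  have ne: "(\<lambda>x. E t x - E 1 x) ` fun_domain E \<psi> \<noteq> {0}"
    using gaps[rule_format, of 1 "ereal t"] t(2) by (simp add: extended_family_def one_ereal_def)
  obtain x where x: "E t x - E 1 x \<noteq> 0"
  proof (rule ccontr)
    assume "\<not> thesis"
    with that have "(\<lambda>x. E t x - E 1 x) = (\<lambda>_. 0)" by blast
    then have "(\<lambda>x. E t x - E 1 x) ` fun_domain E \<psi> = {0}"
      by (simp only: image_constant[OF zero_in_fun_domain[OF E]])
    with ne show False by contradiction
  qed
  define y where "y = E t x - E 1 x"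
  have lower: "(cmod (f 1))\<^sup>2 \<le> (cmod (f u))\<^sup>2" and upper: "(cmod (f u))\<^sup>2 \<le> (cmod (f t))\<^sup>2"
    if "u \<in> {1..<t}" "\<And>r s. 0 < r \<Longrightarrow> r < s \<Longrightarrow> cmod (f r) < cmod (f s)"
    for u and f :: "real \<Rightarrow> complex"
    using that(1) that(2)[of 1 u] that(2)[of u t] by (cases "u = 1"; auto intro!: power_mono)+
  note bounds = norm_fun_operator_increment_bounds[OF E less_imp_le[OF t(2)] y_def]
  note \<phi>b = bounds[OF assms(4) lower[OF _ mono(1)] upper[OF _ mono(1)]]
  note \<psi>b = bounds[OF assms(5) lower[OF _ mono(2)] upper[OF _ mono(2)]]
  have y: "0 < (norm y)\<^sup>2" using x by (simp add: y_def)
  let ?q = "(norm (fun_operator E \<psi> y))\<^sup>2 / (norm y)\<^sup>2"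
  have q: "0 \<le> ?q" "?q \<le> (cmod (\<psi> t))\<^sup>2"
    using \<psi>b(3) y by (simp_all add: pos_divide_le_eq)
  have Fq: "0 \<le> F ?q" "F ?q \<le> (cmod (\<phi> t))\<^sup>2"
    using assms(10)[OF q(1)] strict_mono_onD[OF assms(11), of ?q "(cmod (\<psi> t))\<^sup>2"] q
    unfolding assms(14)[of t] by (auto simp: le_less)
  have "c * (norm y)\<^sup>2 * F ?q \<le> d * (norm y)\<^sup>2 * (cmod (\<phi> t))\<^sup>2"
    using d y Fq by (intro mult_mono) auto
  also have "\<dots> = (d * (cmod (\<phi> t))\<^sup>2) * (norm y)\<^sup>2" by simp
  also have "\<dots> < (cmod (\<phi> 1))\<^sup>2 * (norm y)\<^sup>2" using t(1) y by (rule mult_strict_right_mono)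
  also have "\<dots> \<le> (norm (fun_operator E \<phi> y))\<^sup>2" by (rule \<phi>b(2))
  finally show "\<exists>x\<in>fun_domain E \<psi>. x \<noteq> 0 \<and> (norm (fun_operator E \<phi> x))\<^sup>2
      > c * (norm x)\<^sup>2 * F ((norm (fun_operator E \<psi> x))\<^sup>2 / (norm x)\<^sup>2)"
    using \<psi>b(1) y by (intro bexI[of _ y]) auto
qed

end
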